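(* Let $p\in[0,1]$ and let $\Gamma_{1,2}$ be the percolation Markov decision process on $\mathbb{Z}$ with i.i.d. $\mathrm{Bernoulli}(p)$ payoffs on the vertices and action set $\{1,2\}$. The 1-myopic strategy $$\sigma^*(0)=+2,\qquad \sigma^*(1)=+1$$ (at state $z$, play $+2$ if the payoff at vertex $z+1$ is $0$ and $+1$ if it is $1$) is optimal for any $p$, and the limit value is $v_\infty(p)=2p-p^2$.
   Context: Percolation Markov decision process on $\mathbb{Z}$ with payoffs on the vertices: $I\subset\mathbb{Z}$ is a non-empty finite action set, and $(g_\omega(z))_{z\in\mathbb{Z}}$ are i.i.d. real random variables (here $\mathrm{Bernoulli}(p)$) on a probability space $(\Omega,\mathscr{F},\mathbb{P})$; taking action $i$ at state $z$ gives payoff $g_\omega(z+i)$ and moves the state to $z+i$. The realization $\omega$ of all payoffs is known in advance to the decision maker. A strategy is a sequence $\sigma=(\sigma_m)_{m\ge1}$ of maps $\sigma_m:\Omega\times\mathbb{Z}\to I$ measurable with respect to the product of the $\sigma$-algebra generated by the payoffs and $\mathcal{P}(\mathbb{Z})$; given initial state $z$, it induces $z_1=z$, $i_m=\sigma_m(\omega,z)$, $z_{m+1}=z_m+i_m$. The $n$-stage payoff is $\gamma_n(z,\sigma)=\frac1n\sum_{m=1}^n g_\omega(z_m+i_m)$, the $n$-stage value is $v_n(z)=\max_\sigma\gamma_n(z,\sigma)$, and the limit value $v_\infty(p)$ is the $\mathbb{P}$-almost sure limit of $v_n(z)$ as $n\to\infty$ (a constant independent of $z$). A strategy is stationary if the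 action at each stage depends only on $\omega$ and the current state. A stationary strategy is $k$-myopic if the action depends only on the realization of the payoffs at the next $k$ positions to the right of the current position; $\sigma(x_1\cdots x_k)=i$ means that action $i$ is played at state $z$ whenever $g_\omega(z+j)=x_j$ for $1\le j\le k$. "Optimal" means 0-optimal: for every initial state $z$, $\gamma_n(z,\sigma)\to v_\infty(p)$ as $n\to\infty$, $\mathbb{P}$-a.s. *)

theory Defs
  imports "HOL-Probability.Probability"
begin

text \<open>
  A strategy \<open>\<sigma>\<close> is a family of maps \<open>\<sigma> m \<omega> z\<close> for the stages \<open>m \<ge> 1\<close> (the value at \<open>m = 0\<close>
  is never used), where \<open>z\<close> is the \<^emph>\<open>initial\<close> state, not the current one. Summing
  \<open>z\<^sub>1 = z\<close>, \<open>z\<^sub>m\<^sub>+\<^sub>1 = z\<^sub>m + \<sigma> m \<omega> z\<close> gives the state \<open>z\<^sub>m\<close> at stage \<open>m\<close>.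
\<close>

definition state :: "(nat \<Rightarrow> 'w \<Rightarrow> int \<Rightarrow> int) \<Rightarrow> 'w \<Rightarrow> int \<Rightarrow> nat \<Rightarrow> int" where
  "state \<sigma> \<omega> z m = z + (\<Sum>l\<in>{1..<m}. \<sigma> l \<omega> z)"

lemma state_1: "state \<sigma> \<omega> z 1 = z"
  by (simp add: state_def)

lemma state_Suc: "m \<ge> 1 \<Longrightarrow> state \<sigma> \<omega> z (Suc m) = state \<sigma> \<omega> z m + \<sigma> m \<omega> z"
  by (simp add: state_def)

text \<open>
  The strategy that plays \<open>s \<omega> x\<close> at every stage at which the current state is \<open>x\<close>; see
  \<open>stationary_strategy_eq\<close>.
\<close>

definition stationary_strategy ::
  "('w \<Rightarrow> int \<Rightarrow> int) \<Rightarrow> nat \<Rightarrow> 'w \<Rightarrow> int \<Rightarrow> int" where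
  "stationary_strategy s m \<omega> z = s \<omega> (((\<lambda>x. x + s \<omega> x) ^^ (m - 1)) z)"

lemma stationary_strategy_eq:
  assumes "m \<ge> 1"
  shows "stationary_strategy s m \<omega> z = s \<omega> (state (stationary_strategy s) \<omega> z m)"
proof -
  have "state (stationary_strategy s) \<omega> z (Suc k) = ((\<lambda>x. x + s \<omega> x) ^^ k) z" for k
    by (induction k) (simp_all add: state_Suc state_1[unfolded One_nat_def] stationary_strategy_def)
  from this[of "m - 1"] assms show ?thesis
    by (simp add: stationary_strategy_def)
qed

locale percolation_mdp = prob_space M
  for M :: "'w measure" +
  fixes g :: "int \<Rightarrow> 'w \<Rightarrow> real"
    and I :: "int set"
  assumes finite_actions: "finite I"
    and actions_nonempty: "I \<noteq> {}"
    and payoffs_indep: "indep_vars (\<lambda>_. borel) g UNIV"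
    and payoffs_ident: "\<And>z z'. distr M borel (g z) = distr M borel (g z')"
begin

definition payoff_algebra :: "'w measure" where
  "payoff_algebra = sigma (space M) {g z -` A \<inter> space M | z A. A \<in> sets borel}"

definition strategy :: "(nat \<Rightarrow> 'w \<Rightarrow> int \<Rightarrow> int) \<Rightarrow> bool" where
  "strategy \<sigma> \<longleftrightarrow>
     (\<forall>m\<ge>1. (\<lambda>(\<omega>, z). \<sigma> m \<omega> z) \<in> payoff_algebra \<Otimes>\<^sub>M count_space UNIV \<rightarrow>\<^sub>M count_space I)"

definition payoff :: "nat \<Rightarrow> int \<Rightarrow> (nat \<Rightarrow> 'w \<Rightarrow> int \<Rightarrow> int) \<Rightarrow> 'w \<Rightarrow> real" where
  "payoff n z \<sigma> \<omega> = 1 / real n * (\<Sum>m=1..n. g (state \<sigma> \<omega> z m + \<sigma> m \<omega> z) \<omega>)"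

definition stage_value :: "nat \<Rightarrow> int \<Rightarrow> 'w \<Rightarrow> real" where
  "stage_value n z \<omega> = Max {payoff n z \<sigma> \<omega> | \<sigma>. strategy \<sigma>}"

lemma stage_value_range:
  assumes "\<omega> \<in> space M"
  shows "finite {payoff n z \<sigma> \<omega> | \<sigma>. strategy \<sigma>}"
    and "{payoff n z \<sigma> \<omega> | \<sigma>. strategy \<sigma>} \<noteq> {}"
proof -
  let ?F = "\<lambda>a. 1 / real n * (\<Sum>m=1..n. g (z + (\<Sum>l\<in>{1..<m}. a l) + a m) \<omega>)"
  have "{payoff n z \<sigma> \<omega> | \<sigma>. strategy \<sigma>} \<subseteq> ?F ` (PiE {1..n} (\<lambda>_. I))"
  proof
    fix y assume "y \<in> {payoff n z \<sigma> \<omega> | \<sigma>. strategy \<sigma>}"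
    then obtain \<sigma> where \<sigma>: "strategy \<sigma>" and y: "y = payoff n z \<sigma> \<omega>" by blast
    let ?a = "restrict (\<lambda>m. \<sigma> m \<omega> z) {1..n}"
    have "\<sigma> m \<omega> z \<in> I" if "m \<ge> 1" for m
    proof -
      have "(\<lambda>(\<omega>, z). \<sigma> m \<omega> z) \<in> payoff_algebra \<Otimes>\<^sub>M count_space UNIV \<rightarrow>\<^sub>M count_space I"
        using \<sigma> that by (simp add: strategy_def)
      from measurable_space[OF this, of "(\<omega>, z)"] show ?thesis
        using assms by (simp add: space_pair_measure payoff_algebra_def space_measure_of_conv)
    qed
    then have "?a \<in> PiE {1..n} (\<lambda>_. I)" by auto
    moreover have "y = ?F ?a"
      unfolding y payoff_def state_def by (auto intro!: sum.cong arg_cong2[where f = g])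
    ultimately show "y \<in> ?F ` (PiE {1..n} (\<lambda>_. I))" by blast
  qed
  then show "finite {payoff n z \<sigma> \<omega> | \<sigma>. strategy \<sigma>}"
    by (rule finite_subset) (intro finite_imageI finite_PiE finite_atLeastAtMost finite_actions)
  obtain i where "i \<in> I" using actions_nonempty by blast
  then have "strategy (\<lambda>_ _ _. i)" by (simp add: strategy_def)
  then show "{payoff n z \<sigma> \<omega> | \<sigma>. strategy \<sigma>} \<noteq> {}" by blast
qed

definition has_limit_value :: "real \<Rightarrow> bool" where
  "has_limit_value v \<longleftrightarrow> (\<forall>z. AE \<omega> in M. (\<lambda>n. stage_value n z \<omega>) \<longlonglongrightarrow> v)"

text \<open>Only meaningful when some \<open>v\<close> satisfies \<open>has_limit_value v\<close>.\<close>

definition limit_value :: real where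
  "limit_value = (THE v. has_limit_value v)"

definition optimal :: "(nat \<Rightarrow> 'w \<Rightarrow> int \<Rightarrow> int) \<Rightarrow> bool" where
  "optimal \<sigma> \<longleftrightarrow>
     strategy \<sigma> \<and> (\<forall>z. AE \<omega> in M. (\<lambda>n. payoff n z \<sigma> \<omega>) \<longlonglongrightarrow> limit_value)"

text \<open>The word \<open>x\<^sub>1 \<dots> x\<^sub>k\<close> of the next \<open>k\<close> payoffs is passed to \<open>f\<close> as a list.\<close>

definition myopic_strategy :: "nat \<Rightarrow> (real list \<Rightarrow> int) \<Rightarrow> nat \<Rightarrow> 'w \<Rightarrow> int \<Rightarrow> int" where
  "myopic_strategy k f =
     stationary_strategy (\<lambda>\<omega> z. f (map (\<lambda>j. g (z + int j) \<omega>) [1..<Suc k]))"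

end

text \<open>
  The payoffs are Bernoulli only in distribution, so they may leave \<open>{0, 1}\<close> on a null set;
  there the rule plays \<open>2\<close>, which keeps it valued in \<open>{1, 2}\<close> everywhere.
\<close>

definition sigma_star :: "real list \<Rightarrow> int" where
  "sigma_star xs = (if xs = [1] then 1 else 2)"

end

theory Submission
  imports Defs
begin

text \<open>
  The strategy \<open>\<sigma>\<^sup>*\<close> is optimal for every realization in \<open>{0, 1}\<close> and every horizon, not only in the
  limit: by induction on the horizon, no first action followed by the greedy rule beats the greedy
  rule, because skipping a payoff \<open>1\<close> saves a single stage, worth at most \<open>1\<close>. The stages of the
  greedy walk inspect disjoint sets of vertices, so its total payoff over \<open>n\<close> stages is binomial with
  success probability \<open>p + (1 - p) * p = 2 * p - p\<^sup>2\<close>. Hoeffding's inequality and Borel--Cantelli then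
  give the almost sure limit.
\<close>

section \<open>The greedy walk on a fixed realization\<close>

text \<open>Counting exact ones instead of summing payoffs yields a natural number for every real
  configuration, so the law can be compared with \<open>binomial_pmf\<close> without first
  discarding a null set.\<close>

primrec greedy_total :: "nat \<Rightarrow> (int \<Rightarrow> real) \<Rightarrow> int \<Rightarrow> nat" where
  "greedy_total 0 x z = 0"
| "greedy_total (Suc n) x z =
     (if x (z + 1) = 1 then Suc (greedy_total n x (z + 1))
      else of_bool (x (z + 2) = 1) + greedy_total n x (z + 2))"

text \<open>The greedy rule ignores the horizon, so the longer walk extends the shorter one by a
  single stage, which earns 0 or 1.\<close>

lemma greedy_total_Suc_bounds:
  "greedy_total n x z \<le> greedy_total (Suc n) x z \<and> greedy_total (Suc n) x z \<le> Suc (greedy_total n x z)"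
proof (induction n arbitrary: z)
  case 0
  show ?case by simp
next
  case (Suc n)
  show ?case
    using Suc[of "z + 1"] Suc[of "z + 2"]
    by (simp only: greedy_total.simps(2)[of "Suc n" x z] greedy_total.simps(2)[of n x z]) simp
qed

text \<open>If \<open>x (z + 1) = 1\<close>, the unit step is the greedy move. Otherwise it earns
  nothing and \<open>x (z + 2)\<close> decides. If that is 1, the deviating walk also enters
  \<open>z + 2\<close>, only with one stage fewer left. If not, it reaches \<open>z + 3\<close> via
  \<open>z + 1\<close>, as good as via \<open>z + 2\<close>, and the latter is a unit step from the
  greedy position, covered by induction.\<close>

lemma greedy_total_step_1:
  "of_bool (x (z + 1) = 1) + greedy_total n x (z + 1) \<le> greedy_total (Suc n) x z"
proof (induction n arbitrary: z)
  case 0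
  show ?case by simp
next
  case (Suc n)
  have shift: "z + 1 + 1 = z + 2" "z + 1 + 2 = z + 2 + 1" by simp_all
  show ?case
    using Suc.IH[of "z + 2"] greedy_total_Suc_bounds[of n x "z + 2"]
    by (simp only: greedy_total.simps(2)[of "Suc n" x z] greedy_total.simps(2)[of n x "z + 1"] shift)
      (simp split: if_splits)
qed

text \<open>Only \<open>x (z + 1) = 1\<close> needs an argument: the greedy walk earns 1 at
  \<open>z + 1\<close> and can still make the unit step to \<open>z + 2\<close>, so the jump is
  ahead by one stage, worth at most 1.\<close>

lemma greedy_total_step_2:
  "of_bool (x (z + 2) = 1) + greedy_total n x (z + 2) \<le> greedy_total (Suc n) x z"
proof (cases n)
  case 0
  then show ?thesis by simp
next
  case (Suc k)
  have "of_bool (x (z + 2) = 1) + greedy_total k x (z + 2) \<le> greedy_total n x (z + 1)"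
    using greedy_total_step_1[of x "z + 1" k] Suc by (simp add: add.assoc)
  moreover have "greedy_total n x (z + 2) \<le> Suc (greedy_total k x (z + 2))"
    using greedy_total_Suc_bounds[of k x "z + 2"] Suc by simp
  ultimately show ?thesis
    by (simp only: greedy_total.simps(2)[of n x z]) simp
qed

text \<open>Dynamic programming: by induction the path after its first step may be replaced by the
  greedy walk, and the two step lemmas then handle the first step.\<close>

lemma path_sum_le_greedy_total:
  fixes x :: "int \<Rightarrow> real" and y :: "nat \<Rightarrow> int"
  assumes "\<And>z. x z \<in> {0, 1}" and "\<And>m. y (Suc m) - y m \<in> {1, 2}"
  shows "(\<Sum>m=1..n. x (y m)) \<le> real (greedy_total n x (y 0))"
  using assms(2)
proof (induction n arbitrary: y)
  case 0
  show ?case by simp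
next
  case (Suc n)
  have "(\<Sum>m=1..Suc n. x (y m)) = x (y 1) + (\<Sum>m=1..n. x (y (Suc m)))"
    by (simp add: sum.atLeast_Suc_atMost sum.shift_bounds_cl_Suc_ivl del: sum.cl_ivl_Suc)
  also have "\<dots> \<le> x (y 1) + real (greedy_total n x (y 1))"
    using Suc.IH[of "\<lambda>m. y (Suc m)"] Suc.prems by simp
  also have "x (y 1) = real (of_bool (x (y 1) = 1))"
    using assms(1)[of "y 1"] by auto
  also have "real (of_bool (x (y 1) = 1)) + real (greedy_total n x (y 1))
      = real (of_bool (x (y 1) = 1) + greedy_total n x (y 1))"
    by simp
  also have "\<dots> \<le> real (greedy_total (Suc n) x (y 0))"
  proof -
    from Suc.prems[of 0] have "y 1 = y 0 + 1 \<or> y 1 = y 0 + 2" by auto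
    then show ?thesis
      using greedy_total_step_1[of x "y 0" n] greedy_total_step_2[of x "y 0" n]
      by (metis of_nat_le_iff)
  qed
  finally show ?case .
qed

definition greedy_step :: "(int \<Rightarrow> real) \<Rightarrow> int \<Rightarrow> int" where
  "greedy_step x z = z + (if x (z + 1) = 1 then 1 else 2)"

lemma greedy_walk_sum:
  fixes x :: "int \<Rightarrow> real"
  assumes "\<And>z. x z \<in> {0, 1}"
  shows "(\<Sum>m=1..n. x ((greedy_step x ^^ m) z)) = real (greedy_total n x z)"
proof (induction n arbitrary: z)
  case 0
  show ?case by simp
next
  case (Suc n)
  \<comment> \<open>The first move is split off, not the last, to match the recursion of
    \<open>greedy_total\<close>.\<close>
  have "(\<Sum>m=1..Suc n. x ((greedy_step x ^^ m) z))
      = x (greedy_step x z) + (\<Sum>m=1..n. x ((greedy_step x ^^ m) (greedy_step x z)))"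
    by (simp add: sum.atLeast_Suc_atMost sum.shift_bounds_cl_Suc_ivl funpow_Suc_right
        del: sum.cl_ivl_Suc funpow.simps(2))
  also have "\<dots> = x (greedy_step x z) + real (greedy_total n x (greedy_step x z))"
    by (simp only: Suc.IH)
  also have "\<dots> = real (greedy_total (Suc n) x z)"
    using assms[of "z + 2"] by (auto simp: greedy_step_def)
  finally show ?case .
qed

text \<open>The walk never looks back, so its count factors through the payoffs strictly to the
  right of \<open>z\<close>; independence enters through this.\<close>

lemma greedy_total_restrict:
  "z \<le> y \<Longrightarrow> greedy_total n (restrict x {z<..}) y = greedy_total n x y"
  by (induction n arbitrary: y) simp_all

section \<open>The distribution of the greedy total\<close>

lemma measurable_greedy_total:
  "z \<le> y \<Longrightarrow> (\<lambda>x. greedy_total n x y) \<in> PiM {z<..} (\<lambda>_. borel) \<rightarrow>\<^sub>M count_space UNIV"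
proof (induction n arbitrary: y)
  case 0
  show ?case by simp
next
  case (Suc n)
  have [measurable]: "(\<lambda>x. greedy_total n x (y + 1)) \<in> PiM {z<..} (\<lambda>_. borel) \<rightarrow>\<^sub>M count_space UNIV"
    "(\<lambda>x. greedy_total n x (y + 2)) \<in> PiM {z<..} (\<lambda>_. borel) \<rightarrow>\<^sub>M count_space UNIV"
    using Suc by simp_all
  have [measurable]: "(\<lambda>x. x (y + 1)) \<in> PiM {z<..} (\<lambda>_. borel) \<rightarrow>\<^sub>M (borel :: real measure)"
    "(\<lambda>x. x (y + 2)) \<in> PiM {z<..} (\<lambda>_. borel) \<rightarrow>\<^sub>M (borel :: real measure)"
    using Suc.prems by (auto intro!: measurable_component_singleton)
  show ?case unfolding greedy_total.simps of_bool_def by measurable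
qed

lemma measure_binomial_pmf_Suc:
  assumes "q \<in> {0..1}"
  shows "measure (binomial_pmf (Suc n) q) A =
    q * measure (binomial_pmf n q) (Suc -` A) + (1 - q) * measure (binomial_pmf n q) A"
proof -
  have "binomial_pmf (Suc n) q =
      bernoulli_pmf q \<bind> (\<lambda>b. map_pmf (\<lambda>k. (if b then 1 else 0) + k) (binomial_pmf n q))"
    using assms by (simp add: binomial_pmf_Suc map_pmf_def)
  then have "measure (binomial_pmf (Suc n) q) A =
      measure_pmf.expectation (bernoulli_pmf q)
        (\<lambda>b. measure (binomial_pmf n q) ((\<lambda>k. (if b then 1 else 0) + k) -` A))"
    by (simp add: measure_pmf_bind measure_pmf.measure_bind[where N = "count_space UNIV"]
        measure_pmf_in_subprob_space)
  then show ?thesis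
    using assms by (simp add: vimage_def mult.commute)
qed

lemma double_minus_square_in_unit:
  fixes p :: real
  assumes "p \<in> {0..1}"
  shows "2 * p - p\<^sup>2 \<in> {0..1}"
proof -
  have "2 * p - p\<^sup>2 = 1 - (1 - p)\<^sup>2" by (simp add: algebra_simps power2_eq_square)
  then show ?thesis using assms by (simp add: power_le_one)
qed

context prob_space
begin

lemma random_variable_greedy_total:
  assumes "\<And>z. random_variable borel (g z)"
  shows "random_variable (count_space UNIV) (\<lambda>\<omega>. greedy_total n (\<lambda>j. g j \<omega>) z)"
proof -
  have "(\<lambda>\<omega>. \<lambda>j\<in>{z<..}. g j \<omega>) \<in> M \<rightarrow>\<^sub>M PiM {z<..} (\<lambda>_. borel)"
    by (intro measurable_restrict assms)
  from measurable_compose[OF this measurable_greedy_total[of z z n]] show ?thesis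
    by (simp add: greedy_total_restrict)
qed

text \<open>The index blocks \<open>{z}\<close> and \<open>{z<..}\<close> are disjoint, so functions
  of the corresponding payoffs are independent.\<close>

lemma prob_present_and_future:
  fixes g :: "int \<Rightarrow> 'a \<Rightarrow> real"
  assumes ind: "indep_vars (\<lambda>_. borel) g UNIV" and C: "C \<in> sets borel"
    and Q: "Q \<in> PiM {z<..} (\<lambda>_. borel) \<rightarrow>\<^sub>M count_space UNIV"
  shows "prob {\<omega> \<in> space M. g z \<omega> \<in> C \<and> Q (\<lambda>j\<in>{z<..}. g j \<omega>)} =
    prob {\<omega> \<in> space M. g z \<omega> \<in> C} * prob {\<omega> \<in> space M. Q (\<lambda>j\<in>{z<..}. g j \<omega>)}"
proof -
  have "indep_var (PiM {z} (\<lambda>_. borel)) (\<lambda>\<omega>. restrict (\<lambda>i. g i \<omega>) {z})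
      (PiM {z<..} (\<lambda>_. borel)) (\<lambda>\<omega>. restrict (\<lambda>i. g i \<omega>) {z<..})"
    by (rule indep_var_restrict[OF ind]) auto
  moreover have "(\<lambda>x. x z \<in> C) \<in> PiM {z} (\<lambda>_. borel) \<rightarrow>\<^sub>M count_space UNIV"
    using C by (intro measurable_compose[OF measurable_component_singleton]) auto
  ultimately have "indep_var (count_space UNIV) ((\<lambda>x. x z \<in> C) \<circ> (\<lambda>\<omega>. restrict (\<lambda>i. g i \<omega>) {z}))
      (count_space UNIV) (Q \<circ> (\<lambda>\<omega>. restrict (\<lambda>i. g i \<omega>) {z<..}))"
    using Q by (rule indep_var_compose)
  from indep_varD[OF this, of "{True}" "{True}"] show ?thesis
    by (simp add: vimage_def Int_def conj_commute conj_left_commute)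
qed

lemma prob_greedy_total:
  fixes g :: "int \<Rightarrow> 'a \<Rightarrow> real"
  assumes ind: "indep_vars (\<lambda>_. borel) g UNIV" and p: "p \<in> {0..1}"
    and one: "\<And>z. prob {\<omega> \<in> space M. g z \<omega> = 1} = p"
  shows "prob {\<omega> \<in> space M. greedy_total n (\<lambda>j. g j \<omega>) z \<in> A} =
    measure (binomial_pmf n (2 * p - p\<^sup>2)) A"
proof (induction n arbitrary: z A)
  case 0
  show ?case
    using double_minus_square_in_unit[OF p] by (cases "0 \<in> A") (simp_all add: prob_space binomial_pmf_0)
next
  case (Suc n)
  let ?q = "2 * p - p\<^sup>2"
  let ?G = "\<lambda>k z \<omega>. greedy_total k (\<lambda>j. g j \<omega>) z"
  have [measurable]: "random_variable borel (g z)" for z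
    using ind by (auto simp: indep_vars_def)
  have [measurable]: "random_variable (count_space UNIV) (?G k z)" for k z
    by (rule random_variable_greedy_total) simp
  have other: "prob {\<omega> \<in> space M. g z \<omega> \<in> - {1}} = 1 - p" for z
  proof -
    have "{\<omega> \<in> space M. g z \<omega> \<in> - {1}} = space M - {\<omega> \<in> space M. g z \<omega> = 1}" by auto
    then show ?thesis using one[of z] by (simp add: prob_compl)
  qed
  \<comment> \<open>A walk restarted at the vertex just inspected reads only unseen payoffs, so the
    induction hypothesis gives its law as an independent factor.\<close>
  have future: "prob {\<omega> \<in> space M. g z \<omega> \<in> C \<and> ?G n z \<omega> \<in> B} =
      prob {\<omega> \<in> space M. g z \<omega> \<in> C} * measure (binomial_pmf n ?q) B"
    if "C \<in> sets borel" for C B z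
  proof -
    have [measurable]: "(\<lambda>x. greedy_total n x z) \<in> PiM {z<..} (\<lambda>_. borel) \<rightarrow>\<^sub>M count_space UNIV"
      by (rule measurable_greedy_total) simp
    have "(\<lambda>x. greedy_total n x z \<in> B) \<in> PiM {z<..} (\<lambda>_. borel) \<rightarrow>\<^sub>M count_space UNIV"
      by measurable
    from prob_present_and_future[OF ind that this] show ?thesis
      by (simp add: greedy_total_restrict Suc.IH)
  qed
  \<comment> \<open>After a jump two vertices have been inspected: \<open>z + 1\<close> is factored
    off first, then \<open>future\<close> is applied at \<open>z + 2\<close>.\<close>
  have future2: "prob {\<omega> \<in> space M. g (z + 1) \<omega> \<in> C \<and> g (z + 2) \<omega> \<in> D \<and> ?G n (z + 2) \<omega> \<in> B} =
      prob {\<omega> \<in> space M. g (z + 1) \<omega> \<in> C} *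
      (prob {\<omega> \<in> space M. g (z + 2) \<omega> \<in> D} * measure (binomial_pmf n ?q) B)"
    if "C \<in> sets borel" and [measurable]: "D \<in> sets borel" for C D B z
  proof -
    have [measurable]:
      "(\<lambda>x. greedy_total n x (z + 2)) \<in> PiM {z + 1<..} (\<lambda>_. borel) \<rightarrow>\<^sub>M count_space UNIV"
      by (rule measurable_greedy_total) simp
    have [measurable]: "(\<lambda>x. x (z + 2)) \<in> PiM {z + 1<..} (\<lambda>_. borel) \<rightarrow>\<^sub>M (borel :: real measure)"
      by (auto intro!: measurable_component_singleton)
    have "(\<lambda>x. x (z + 2) \<in> D \<and> greedy_total n x (z + 2) \<in> B)
        \<in> PiM {z + 1<..} (\<lambda>_. borel) \<rightarrow>\<^sub>M count_space UNIV"
      by measurable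
    from prob_present_and_future[OF ind that(1) this] show ?thesis
      by (simp add: greedy_total_restrict future)
  qed
  \<comment> \<open>The three outcomes of the first stage: a unit step onto a 1, a jump onto a 1,
    and a jump that earns nothing.\<close>
  let ?E1 = "{\<omega> \<in> space M. g (z + 1) \<omega> \<in> {1} \<and> ?G n (z + 1) \<omega> \<in> Suc -` A}"
  let ?E2 = "{\<omega> \<in> space M. g (z + 1) \<omega> \<in> - {1} \<and> g (z + 2) \<omega> \<in> {1} \<and> ?G n (z + 2) \<omega> \<in> Suc -` A}"
  let ?E3 = "{\<omega> \<in> space M. g (z + 1) \<omega> \<in> - {1} \<and> g (z + 2) \<omega> \<in> - {1} \<and> ?G n (z + 2) \<omega> \<in> A}"
  have sets: "?E1 \<in> events" "?E2 \<in> events" "?E3 \<in> events"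
    by measurable
  have split: "{\<omega> \<in> space M. ?G (Suc n) z \<omega> \<in> A} = ?E1 \<union> (?E2 \<union> ?E3)"
    by auto
  have "prob (?E1 \<union> (?E2 \<union> ?E3)) = prob ?E1 + prob (?E2 \<union> ?E3)"
    using sets by (intro finite_measure_Union) auto
  moreover have "prob (?E2 \<union> ?E3) = prob ?E2 + prob ?E3"
    using sets by (intro finite_measure_Union) auto
  moreover have "prob ?E1 = p * measure (binomial_pmf n ?q) (Suc -` A)"
    by (subst future) (simp_all add: one)
  moreover have "prob ?E2 = (1 - p) * (p * measure (binomial_pmf n ?q) (Suc -` A))"
    by (subst future2) (simp_all add: one other[simplified])
  moreover have "prob ?E3 = (1 - p) * ((1 - p) * measure (binomial_pmf n ?q) A)"
    by (subst future2) (simp_all add: other[simplified])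
  moreover have "measure (binomial_pmf (Suc n) ?q) A =
      ?q * measure (binomial_pmf n ?q) (Suc -` A) + (1 - ?q) * measure (binomial_pmf n ?q) A"
    by (rule measure_binomial_pmf_Suc[OF double_minus_square_in_unit[OF p]])
  \<comment> \<open>The coefficients agree because \<open>p + (1 - p) * p = ?q\<close> and
    \<open>(1 - p) * (1 - p) = 1 - ?q\<close>.\<close>
  ultimately show ?case
    unfolding split by (simp only:) (simp add: algebra_simps power2_eq_square)
qed

text \<open>Hoeffding's tails are geometric in \<open>n\<close>, hence summable, and the first
  Borel-Cantelli lemma requires only the law of each \<open>X n\<close>, not their joint
  law.\<close>

lemma AE_binomial_tendsto:
  fixes X :: "nat \<Rightarrow> 'a \<Rightarrow> nat"
  assumes X [measurable]: "\<And>n. random_variable (count_space UNIV) (X n)" and q: "q \<in> {0..1}"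
    and binomial: "\<And>n A. prob {\<omega> \<in> space M. X n \<omega> \<in> A} = measure (binomial_pmf n q) A"
  shows "AE \<omega> in M. (\<lambda>n. real (X n \<omega>) / real n) \<longlonglongrightarrow> q"
proof -
  have "AE \<omega> in M. \<forall>\<^sub>F n in sequentially. \<bar>real (X n \<omega>) / real n - q\<bar> < e" if e: "e > 0" for e :: real
  proof -
    let ?B = "\<lambda>n. {\<omega> \<in> space M. X n \<omega> \<in> {k. \<bar>real k / real n - q\<bar> \<ge> e}}"
    have bound: "prob (?B n) \<le> 2 * exp (- 2 * e\<^sup>2) ^ n" for n
    \<comment> \<open>At \<open>n = 0\<close> the bound is 2, which every probability satisfies;
      Hoeffding's inequality is applied for positive \<open>n\<close>.\<close>
    proof (cases "n = 0")
      case True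
      have "prob (?B n) \<le> 2" using prob_le_1[of "?B n"] by linarith
      with True show ?thesis by simp
    next
      case False
      interpret binomial_distribution n q
        by unfold_locales (rule q)
      show ?thesis
        using prob_abs_ge'[of e] e False
        by (simp only: binomial) (simp add: exp_of_nat_mult[symmetric] mult_ac)
    qed
    have "summable (\<lambda>n. 2 * exp (- 2 * e\<^sup>2) ^ n)"
      using e by (intro summable_mult summable_geometric) simp
    then have "summable (\<lambda>n. prob (?B n))"
      by (rule summable_comparison_test') (use bound in auto)
    then have "AE \<omega> in M. \<forall>\<^sub>F n in sequentially. \<omega> \<in> space M - ?B n"
      by (intro borel_cantelli_AE1) (auto simp: emeasure_eq_measure)
    then show ?thesis
      by (rule AE_mp) (auto elim!: eventually_mono intro!: AE_I2)
  qed
  \<comment> \<open>Countably many tolerances suffice for convergence, so a single null set serves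
    them all.\<close>
  then have "AE \<omega> in M. \<forall>j. \<forall>\<^sub>F n in sequentially.
      \<bar>real (X n \<omega>) / real n - q\<bar> < 1 / real (Suc j)"
    by (subst AE_all_countable) simp
  then show ?thesis
  proof (rule AE_mp, intro AE_I2 impI)
    fix \<omega>
    assume close: "\<forall>j. \<forall>\<^sub>F n in sequentially. \<bar>real (X n \<omega>) / real n - q\<bar> < 1 / real (Suc j)"
    show "(\<lambda>n. real (X n \<omega>) / real n) \<longlonglongrightarrow> q"
    proof (rule tendstoI)
      fix e :: real assume "0 < e"
      then obtain j where "1 / real (Suc j) < e" using nat_approx_posE by blast
      with close[rule_format, of j]
      show "\<forall>\<^sub>F n in sequentially. dist (real (X n \<omega>) / real n) q < e"
        by (auto elim!: eventually_mono simp: dist_real_def)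
    qed
  qed
qed

end

section \<open>Optimality of the greedy strategy\<close>

context percolation_mdp
begin

lemma limit_value_eq:
  assumes "has_limit_value v"
  shows "limit_value = v"
  unfolding limit_value_def
proof (rule the_equality[where P = has_limit_value])
  fix w assume "has_limit_value w"
  with assms have "AE \<omega> in M. (\<lambda>n. stage_value n 0 \<omega>) \<longlonglongrightarrow> v"
    "AE \<omega> in M. (\<lambda>n. stage_value n 0 \<omega>) \<longlonglongrightarrow> w"
    by (auto simp: has_limit_value_def)
  then have "AE \<omega> in M. w = v"
    by eventually_elim (rule LIMSEQ_unique)
  \<comment> \<open>A probability space is not null, so a constant statement true almost everywhere
    is true.\<close>
  then show "w = v" by simp
qed (rule assms)

text \<open>Membership in \<open>I\<close> is encoded in the codomain \<open>count_space I\<close>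
  of the measurability condition.\<close>

lemma strategy_in_actions:
  assumes "strategy \<sigma>" "\<omega> \<in> space M" "m \<ge> 1"
  shows "\<sigma> m \<omega> z \<in> I"
proof -
  have "(\<lambda>(\<omega>, z). \<sigma> m \<omega> z) \<in> payoff_algebra \<Otimes>\<^sub>M count_space UNIV \<rightarrow>\<^sub>M count_space I"
    using assms by (simp add: strategy_def)
  from measurable_space[OF this, of "(\<omega>, z)"] show ?thesis
    using assms by (simp add: space_pair_measure payoff_algebra_def space_measure_of_conv)
qed

text \<open>A stage collects the payoff of the state it enters, hence the index shift; with it,
  \<open>m = 0\<close> gives the initial state, as in the path and walk lemmas.\<close>

lemma payoff_eq_state_sum:
  "payoff n z \<sigma> \<omega> = (\<Sum>m=1..n. g (state \<sigma> \<omega> z (Suc m)) \<omega>) / real n"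
  unfolding payoff_def by (simp add: state_Suc)

lemma payoff_le_greedy_total:
  assumes "I = {1, 2}" "strategy \<sigma>" "\<omega> \<in> space M" "\<And>z. g z \<omega> \<in> {0, 1}"
  shows "payoff n z \<sigma> \<omega> \<le> real (greedy_total n (\<lambda>j. g j \<omega>) z) / real n"
proof -
  have "state \<sigma> \<omega> z (Suc (Suc m)) - state \<sigma> \<omega> z (Suc m) \<in> {1, 2}" for m
    using strategy_in_actions[OF assms(2,3), of "Suc m" z] assms(1) by (simp add: state_Suc)
  then have "(\<Sum>m=1..n. g (state \<sigma> \<omega> z (Suc m)) \<omega>) \<le> real (greedy_total n (\<lambda>j. g j \<omega>) z)"
    using path_sum_le_greedy_total[of "\<lambda>j. g j \<omega>" "\<lambda>m. state \<sigma> \<omega> z (Suc m)" n] assms(4)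
    by (simp add: state_1[unfolded One_nat_def])
  then show ?thesis
    unfolding payoff_eq_state_sum by (rule divide_right_mono) simp
qed

lemma myopic_sigma_star_eq:
  "myopic_strategy 1 sigma_star =
    stationary_strategy (\<lambda>\<omega> z. if g (z + 1) \<omega> = 1 then 1 else 2)"
  by (simp add: myopic_strategy_def sigma_star_def)

lemma state_myopic_sigma_star:
  "state (myopic_strategy 1 sigma_star) \<omega> z (Suc m) = (greedy_step (\<lambda>j. g j \<omega>) ^^ m) z"
proof (induction m)
  case 0
  show ?case by (simp add: state_1[unfolded One_nat_def])
next
  case (Suc m)
  then show ?case
    by (simp add: state_Suc greedy_step_def myopic_sigma_star_eq[unfolded One_nat_def] stationary_strategy_eq)
qed

lemma payoff_myopic_sigma_star:
  assumes "\<And>z. g z \<omega> \<in> {0, 1}"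
  shows "payoff n z (myopic_strategy 1 sigma_star) \<omega> = real (greedy_total n (\<lambda>j. g j \<omega>) z) / real n"
  unfolding payoff_eq_state_sum state_myopic_sigma_star
  using greedy_walk_sum[where x = "\<lambda>j. g j \<omega>" and n = n and z = z] assms by simp

lemma strategy_myopic_sigma_star:
  assumes "I = {1, 2}"
  shows "strategy (myopic_strategy 1 sigma_star)"
  unfolding strategy_def
proof (intro allI impI)
  fix m :: nat
  let ?s = "\<lambda>\<omega> z. if g (z + 1) \<omega> = 1 then 1 else 2 :: int"
  have [measurable]: "g z \<in> payoff_algebra \<rightarrow>\<^sub>M borel" for z
    unfolding payoff_algebra_def
    by (rule measurableI) (auto simp: space_measure_of_conv intro!: in_measure_of)
  \<comment> \<open>The function \<open>h\<close> covers the displaced position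
    \<open>y + ?s \<omega> y\<close> for each fixed \<open>y\<close>.\<close>
  have step: "(\<lambda>\<omega>. h (?s \<omega> y)) \<in> payoff_algebra \<rightarrow>\<^sub>M count_space UNIV" for y and h :: "int \<Rightarrow> int"
    by measurable
  have pos: "(\<lambda>\<omega>. ((\<lambda>x. x + ?s \<omega> x) ^^ k) z) \<in> payoff_algebra \<rightarrow>\<^sub>M count_space UNIV" for k z
  proof (induction k)
    case 0
    show ?case by simp
  next
    case (Suc k)
    \<comment> \<open>The current position is random but integer-valued, so measurability at each
      fixed position suffices. The same countability argument later handles the action and the
      initial state.\<close>
    have "(\<lambda>\<omega>. (\<lambda>x. x + ?s \<omega> x) (((\<lambda>x. x + ?s \<omega> x) ^^ k) z)) \<in> payoff_algebra \<rightarrow>\<^sub>M count_space UNIV"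
      by (rule measurable_compose_countable'[where I = UNIV and f = "\<lambda>x \<omega>. x + ?s \<omega> x", OF step Suc]) simp
    then show ?case by simp
  qed
  have action: "(\<lambda>\<omega>. ?s \<omega> (((\<lambda>x. x + ?s \<omega> x) ^^ k) z)) \<in> payoff_algebra \<rightarrow>\<^sub>M count_space {1, 2}" for k z
    by (rule measurable_compose_countable'[where I = UNIV and f = "\<lambda>x \<omega>. ?s \<omega> x", OF _ pos]) auto
  have "(\<lambda>w. ?s (fst w) (((\<lambda>x. x + ?s (fst w) x) ^^ (m - 1)) (snd w)))
      \<in> payoff_algebra \<Otimes>\<^sub>M count_space UNIV \<rightarrow>\<^sub>M count_space {1, 2}"
    by (rule measurable_compose_countable'[where I = UNIV and g = snd
          and f = "\<lambda>z w. ?s (fst w) (((\<lambda>x. x + ?s (fst w) x) ^^ (m - 1)) z)"])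
      (auto intro!: measurable_compose[OF measurable_fst action])
  then show "(\<lambda>(\<omega>, z). myopic_strategy 1 sigma_star m \<omega> z)
      \<in> payoff_algebra \<Otimes>\<^sub>M count_space UNIV \<rightarrow>\<^sub>M count_space I"
    unfolding myopic_sigma_star_eq stationary_strategy_def assms split_beta .
qed

text \<open>The upper bound over all strategies is attained by the myopic strategy, pointwise in
  \<open>\<omega>\<close> and at every horizon.\<close>

lemma stage_value_eq_greedy_total:
  assumes "I = {1, 2}" "\<omega> \<in> space M" "\<And>z. g z \<omega> \<in> {0, 1}"
  shows "stage_value n z \<omega> = real (greedy_total n (\<lambda>j. g j \<omega>) z) / real n"
  unfolding stage_value_def
proof (rule Max_eqI)
  show "finite {payoff n z \<sigma> \<omega> | \<sigma>. strategy \<sigma>}"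
    by (rule stage_value_range) fact
  show "real (greedy_total n (\<lambda>j. g j \<omega>) z) / real n \<in> {payoff n z \<sigma> \<omega> | \<sigma>. strategy \<sigma>}"
    using payoff_myopic_sigma_star[OF assms(3), where n = n and z = z] strategy_myopic_sigma_star[OF assms(1)]
    by force
qed (use payoff_le_greedy_total[OF assms(1) _ assms(2,3)] in blast)

end

theorem proposition4p3:
  fixes M :: "'w measure" and g :: "int \<Rightarrow> 'w \<Rightarrow> real" and p :: real
  assumes "0 \<le> p" and "p \<le> 1"
    and "percolation_mdp M g {1, 2}"
    and "\<And>z. distr M borel (g z) = distr (measure_pmf (bernoulli_pmf p)) borel (of_bool :: bool \<Rightarrow> real)"
  shows "percolation_mdp.optimal M g {1, 2} (percolation_mdp.myopic_strategy g 1 sigma_star) \<and>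
         percolation_mdp.has_limit_value M g {1, 2} (2 * p - p\<^sup>2) \<and>
         percolation_mdp.limit_value M g {1, 2} = 2 * p - p\<^sup>2"
proof -
  interpret percolation_mdp M g "{1, 2}" by fact
  let ?\<sigma> = "myopic_strategy 1 sigma_star"
  let ?q = "2 * p - p\<^sup>2"
  let ?G = "\<lambda>n z \<omega>. greedy_total n (\<lambda>j. g j \<omega>) z"
  have [measurable]: "random_variable borel (g z)" for z
    using payoffs_indep by (auto simp: indep_vars_def)
  have prob_g: "prob {\<omega> \<in> space M. g z \<omega> \<in> C} = measure (bernoulli_pmf p) (of_bool -` C)"
    if [measurable]: "C \<in> sets borel" for C z
  proof -
    have "prob {\<omega> \<in> space M. g z \<omega> \<in> C} = measure (distr M borel (g z)) C"
      by (subst measure_distr) (auto simp: vimage_def Int_def conj_commute)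
    also have "\<dots> = measure (bernoulli_pmf p) (of_bool -` C)"
      unfolding assms(4) by (subst measure_distr) auto
    finally show ?thesis .
  qed
  have one: "prob {\<omega> \<in> space M. g z \<omega> = 1} = p" for z
  proof -
    \<comment> \<open>The law of a payoff is an image of \<open>bernoulli_pmf p\<close> under
      \<open>of_bool\<close>, so its probabilities are read off from preimages.\<close>
    have "of_bool -` {1 :: real} = {True}" by auto
    then show ?thesis
      using prob_g[of "{1}" z] assms(1,2) by (simp add: measure_pmf_single)
  qed
  have "prob {\<omega> \<in> space M. g z \<omega> \<in> {0, 1}} = 1" for z
  proof -
    have "of_bool -` {0, 1 :: real} = UNIV" by auto
    then show ?thesis using prob_g[of "{0, 1}" z] by simp
  qed
  then have "AE \<omega> in M. g z \<omega> \<in> {0, 1}" for z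
    by (subst (asm) prob_Collect_eq_1) auto
  \<comment> \<open>The vertices are countable, so one null set excludes every realization with a
    payoff outside \<open>{0, 1}\<close>.\<close>
  then have AE01: "AE \<omega> in M. \<forall>z. g z \<omega> \<in> {0, 1}"
    by (subst AE_all_countable) simp
  have q: "?q \<in> {0..1}"
    using assms(1,2) by (intro double_minus_square_in_unit) simp
  have greedy_limit: "AE \<omega> in M. (\<lambda>n. real (?G n z \<omega>) / real n) \<longlonglongrightarrow> ?q" for z
  proof (rule AE_binomial_tendsto[OF _ q])
    show "prob {\<omega> \<in> space M. ?G n z \<omega> \<in> A} = measure (binomial_pmf n ?q) A" for n A
      using assms(1,2) by (intro prob_greedy_total payoffs_indep one) simp
    show "random_variable (count_space UNIV) (?G n z)" for n
      by (rule random_variable_greedy_total) simp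
  qed
  \<comment> \<open>Off that null set, the stage value and the payoff of \<open>?\<sigma>\<close>
    both equal the greedy average, so they share its limit.\<close>
  have "AE \<omega> in M. (\<lambda>n. stage_value n z \<omega>) \<longlonglongrightarrow> ?q" for z
    using greedy_limit[of z] AE01 AE_space
    by eventually_elim (simp add: stage_value_eq_greedy_total)
  then have limit: "has_limit_value ?q"
    by (simp add: has_limit_value_def)
  moreover have "AE \<omega> in M. (\<lambda>n. payoff n z ?\<sigma> \<omega>) \<longlonglongrightarrow> ?q" for z
    using greedy_limit[of z] AE01
    by eventually_elim (simp add: payoff_myopic_sigma_star[unfolded One_nat_def])
  ultimately show ?thesis
    using strategy_myopic_sigma_star limit_value_eq[OF limit] by (simp add: optimal_def)
qed

end
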